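(* Consider the generalized semi-infinite program (GSIP) $$\min_{z\in\mathcal Z} f(z)\quad\text{s.t.}\quad g(z,v)\le 0\ \ \forall v\in\mathcal V(z),\qquad \mathcal V(z)=\{v\in\bar{\mathcal V}: h(z,v)\ge 0,\ r(z,v)=0\},$$ and suppose the determined-part assumption (b) of the context holds. Consider the existence-constrained semi-infinite program $$\min_{z\in\mathcal Z} f(z)\quad\text{s.t.}\quad \forall q\in\bar{\mathcal Q},\ v=(p,q)\text{ with } r(z,(p,q))=0,\ \forall i\in[n_g],\ \exists \lambda_i\in\Lambda_{n_h+1}:\ \lambda_{i,1}g_i(z,v)+\sum_{j=1}^{n_h}\lambda_{i,j+1}h_j(z,v)\le 0, \qquad (\mathrm{E})$$ where $\Lambda_{n_h+1}=\{\lambda\in\mathbb R^{n_h+1}:\sum_{j=1}^{n_h+1}\lambda_j=1,\ \lambda_j\ge 0\}$ is the probability simplex. Then: 1. (Equivalence in the non-strict sense.) (E) is equivalent to the program $$\min_{z\in\mathcal Z} f(z)\quad\text{s.t.}\quad \forall q\in\bar{\mathcal Q},\ v=(p,q)\text{ with } r(z,(p,q))=0:\ \ [g(z,v)\le 0]\ \lor\ \Big[\min_{j\in[n_h]}h_j(z,v)\le 0\Big].$$ 2. (Exactness.) If in addition the smoothness assumption (c) of the context holds, and for every $z\in\mathcal Z$ the set of strictly admissible indices $\{q\in\bar{\mathcal Q}: h(z,(p,q))>0\}$ is dense in $A(z)=\{q\in\bar{\mathcal Q}: h(z,(p,q))\ge 0\}$ (where $p$ is the unique root of $r(z,(p,q))=0$),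 then (E) is equivalent to the original GSIP. 3. (Differentiability.) With $p$ retained as a variable constrained by $r(z,(p,q))=0$, under assumption (c) the objective and constraint functions of (E), i.e. $f(z)$, $r(z,(p,q))$ and $\lambda_{i,1}g_i(z,(p,q))+\sum_{j=1}^{n_h}\lambda_{i,j+1}h_j(z,(p,q))$ as functions of $(z,p,q,\lambda_i)$, are $\rho$-times differentiable.
   Context: Notation: $[n]=\{1,\dots,n\}$ for a positive integer $n$; vector inequalities are componentwise. Two programs are "equivalent" if they have the same objective in $z$ and the same set of feasible $z\in\mathcal Z$. Data: $\mathcal Z\subseteq\mathbb R^{n_z}$ is the decision set, $\bar{\mathcal V}\subset\mathbb R^{n_v}$ is bounded, $f:\mathcal Z\to\mathbb R$, $g:\mathcal Z\times\bar{\mathcal V}\to\mathbb R^{n_g}$, $h:\mathcal Z\times\bar{\mathcal V}\to\mathbb R^{n_h}$, $r:\mathcal Z\times\bar{\mathcal V}\to\mathbb R^{n_r}$. Assumption (b) (determined part): there is a partition $v=(p,q)$ with $p\in\mathbb R^{n_r}$, $q\in\bar{\mathcal Q}\subset\mathbb R^{n_v-n_r}$, $\bar{\mathcal Q}$ compact, such that, with $Q(z)=\{q:\exists p,\ (p,q)\in\mathcal V(z)\}$, for every $z\in\mathcal Z$: (i) for each $q\in\bar{\mathcal Q}$, the equation $r(z,(p,q))=0$ has a unique solution $p$, which is continuous in $(z,q)$; (ii) $Q(z)\subseteq\bar{\mathcal Q}$; (iii) every $(p,q)$ with $r(z,(p,q))=0$ and $q\in\bar{\mathcal Q}$ (including those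 where $h\not\ge 0$) lies in $\operatorname{int}(\bar{\mathcal V})$. Assumption (c) (smoothness): $f,g,h,r\in\mathcal C^\rho$ for some $\rho\in\{0,1,\dots,+\infty\}$, meaning $\rho$-times differentiable for $\rho\ge1$ and continuous for $\rho=0$; "$\rho$-times differentiable" in the claim is meant in this same sense. *)

theory Defs
  imports "HOL-Analysis.Analysis" "HOL-Library.Extended_Nat"
begin

datatype 'z program =
  Program (decision: "'z set") (objective: "'z \<Rightarrow> real") (constraint: "'z \<Rightarrow> bool")

definition feasible :: "'z program \<Rightarrow> 'z set" where
  "feasible P = {z \<in> decision P. constraint P z}"

definition equivalent :: "'z program \<Rightarrow> 'z program \<Rightarrow> bool" where
  "equivalent P P' \<longleftrightarrow>
     decision P = decision P' \<and>
     (\<forall>z\<in>decision P. objective P z = objective P' z) \<and>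
     feasible P = feasible P'"

text \<open>
  The space of lower-level variables is written as the product of the space of \<open>p\<close> and
  the space of \<open>q\<close>. The functions \<open>g\<close>, \<open>h\<close> and \<open>r\<close> are only meaningful for arguments
  \<open>v \<in> Vbar\<close>, so a root of \<open>r z\<close> is required to lie in \<open>Vbar\<close>.
\<close>

definition is_root ::
  "('z \<Rightarrow> 'p \<times> 'q \<Rightarrow> real^'r) \<Rightarrow> ('p \<times> 'q) set \<Rightarrow> 'z \<Rightarrow> 'q \<Rightarrow> 'p \<Rightarrow> bool" where
  "is_root r Vbar z q p \<longleftrightarrow> (p, q) \<in> Vbar \<and> r z (p, q) = 0"

definition root_of ::
  "('z \<Rightarrow> 'p \<times> 'q \<Rightarrow> real^'r) \<Rightarrow> ('p \<times> 'q) set \<Rightarrow> 'z \<Rightarrow> 'q \<Rightarrow> 'p" where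
  "root_of r Vbar z q = (THE p. is_root r Vbar z q p)"

definition lower_set ::
  "'v set \<Rightarrow> ('z \<Rightarrow> 'v \<Rightarrow> real^'h) \<Rightarrow> ('z \<Rightarrow> 'v \<Rightarrow> real^'r) \<Rightarrow> 'z \<Rightarrow> 'v set" where
  "lower_set Vbar h r z = {v \<in> Vbar. (\<forall>j. 0 \<le> h z v $ j) \<and> r z v = 0}"

definition determined_part ::
  "(real^'z) set \<Rightarrow> ((real^'r) \<times> (real^'q)) set \<Rightarrow> (real^'q) set \<Rightarrow>
   (real^'z \<Rightarrow> (real^'r) \<times> (real^'q) \<Rightarrow> real^'h) \<Rightarrow>
   (real^'z \<Rightarrow> (real^'r) \<times> (real^'q) \<Rightarrow> real^'r) \<Rightarrow> bool" where
  "determined_part Z Vbar Qbar h r \<longleftrightarrow>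
     compact Qbar \<and>
     (\<forall>z\<in>Z. \<forall>q\<in>Qbar. \<exists>!p. is_root r Vbar z q p) \<and>
     continuous_on (Z \<times> Qbar) (\<lambda>(z, q). root_of r Vbar z q) \<and>
     (\<forall>z\<in>Z. {q. \<exists>p. (p, q) \<in> lower_set Vbar h r z} \<subseteq> Qbar) \<and>
     (\<forall>z\<in>Z. \<forall>q\<in>Qbar. \<forall>p. is_root r Vbar z q p \<longrightarrow> (p, q) \<in> interior Vbar)"

text \<open>
  A function is \<open>Suc k\<close> times differentiable if it is differentiable and every directional
  component \<open>x \<mapsto> Df(x) v\<close> of its derivative is \<open>k\<close> times differentiable; in finite dimension
  this is the same as \<open>k\<close>-fold differentiability of the operator-valued map \<open>Df\<close>. Derivatives are
  taken within \<open>S\<close>, as the domains need not be open; at interior points of \<open>S\<close> they are the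
  usual ones. The highest derivative is not required to be continuous.
\<close>

primrec times_differentiable_on ::
  "nat \<Rightarrow> ('a::real_normed_vector \<Rightarrow> 'b::real_normed_vector) \<Rightarrow> 'a set \<Rightarrow> bool" where
  "times_differentiable_on 0 f S \<longleftrightarrow> True"
| "times_differentiable_on (Suc k) f S \<longleftrightarrow>
     (\<exists>f'. (\<forall>x\<in>S. (f has_derivative f' x) (at x within S)) \<and>
           (\<forall>v. times_differentiable_on k (\<lambda>x. f' x v) S))"

definition C_class ::
  "enat \<Rightarrow> ('a::real_normed_vector \<Rightarrow> 'b::real_normed_vector) \<Rightarrow> 'a set \<Rightarrow> bool" where
  "C_class \<rho> f S \<longleftrightarrow>
     (if \<rho> = 0 then continuous_on S f
      else (\<forall>k. enat k \<le> \<rho> \<longrightarrow> times_differentiable_on k f S))"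

definition smooth_data ::
  "enat \<Rightarrow> (real^'z) set \<Rightarrow> ((real^'r) \<times> (real^'q)) set \<Rightarrow> (real^'z \<Rightarrow> real) \<Rightarrow>
   (real^'z \<Rightarrow> (real^'r) \<times> (real^'q) \<Rightarrow> real^'g) \<Rightarrow>
   (real^'z \<Rightarrow> (real^'r) \<times> (real^'q) \<Rightarrow> real^'h) \<Rightarrow>
   (real^'z \<Rightarrow> (real^'r) \<times> (real^'q) \<Rightarrow> real^'r) \<Rightarrow> bool" where
  "smooth_data \<rho> Z Vbar f g h r \<longleftrightarrow>
     C_class \<rho> f Z \<and>
     C_class \<rho> (\<lambda>(z, v). g z v) (Z \<times> Vbar) \<and>
     C_class \<rho> (\<lambda>(z, v). h z v) (Z \<times> Vbar) \<and>
     C_class \<rho> (\<lambda>(z, v). r z v) (Z \<times> Vbar)"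

definition prob_simplex :: "(real^'n) set" where
  "prob_simplex = {l. (\<Sum>j\<in>UNIV. l $ j) = 1 \<and> (\<forall>j. 0 \<le> l $ j)}"

text \<open>
  The \<open>n\<^sub>h + 1\<close> multipliers are indexed by \<open>'h option\<close>: the index \<open>None\<close> belongs to \<open>g\<close> and
  \<open>Some j\<close> belongs to the \<open>j\<close>-th component of \<open>h\<close>.
\<close>

definition weighted_sum ::
  "('z \<Rightarrow> 'v \<Rightarrow> real^'g) \<Rightarrow> ('z \<Rightarrow> 'v \<Rightarrow> real^'h) \<Rightarrow> 'g \<Rightarrow> 'z \<Rightarrow> 'v \<Rightarrow> real^('h option) \<Rightarrow> real"
  where
  "weighted_sum g h i z v l =
     l $ None * g z v $ i + (\<Sum>j\<in>UNIV. l $ Some j * h z v $ j)"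

definition gsip ::
  "'z set \<Rightarrow> 'v set \<Rightarrow> ('z \<Rightarrow> real) \<Rightarrow> ('z \<Rightarrow> 'v \<Rightarrow> real^'g) \<Rightarrow> ('z \<Rightarrow> 'v \<Rightarrow> real^'h) \<Rightarrow>
   ('z \<Rightarrow> 'v \<Rightarrow> real^'r) \<Rightarrow> 'z program" where
  "gsip Z Vbar f g h r =
     Program Z f (\<lambda>z. \<forall>v\<in>lower_set Vbar h r z. \<forall>i. g z v $ i \<le> 0)"

definition existence_sip ::
  "'z set \<Rightarrow> ('p \<times> 'q) set \<Rightarrow> 'q set \<Rightarrow> ('z \<Rightarrow> real) \<Rightarrow>
   ('z \<Rightarrow> 'p \<times> 'q \<Rightarrow> real^'g) \<Rightarrow> ('z \<Rightarrow> 'p \<times> 'q \<Rightarrow> real^'h) \<Rightarrow>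
   ('z \<Rightarrow> 'p \<times> 'q \<Rightarrow> real^'r) \<Rightarrow> 'z program" where
  "existence_sip Z Vbar Qbar f g h r =
     Program Z f (\<lambda>z. \<forall>q\<in>Qbar. \<forall>p. is_root r Vbar z q p \<longrightarrow>
       (\<forall>i. \<exists>l\<in>prob_simplex. weighted_sum g h i z (p, q) l \<le> 0))"

definition disjunctive_sip ::
  "'z set \<Rightarrow> ('p \<times> 'q) set \<Rightarrow> 'q set \<Rightarrow> ('z \<Rightarrow> real) \<Rightarrow>
   ('z \<Rightarrow> 'p \<times> 'q \<Rightarrow> real^'g) \<Rightarrow> ('z \<Rightarrow> 'p \<times> 'q \<Rightarrow> real^'h) \<Rightarrow>
   ('z \<Rightarrow> 'p \<times> 'q \<Rightarrow> real^'r) \<Rightarrow> 'z program" where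
  "disjunctive_sip Z Vbar Qbar f g h r =
     Program Z f (\<lambda>z. \<forall>q\<in>Qbar. \<forall>p. is_root r Vbar z q p \<longrightarrow>
       (\<forall>i. g z (p, q) $ i \<le> 0) \<or> (MIN j. h z (p, q) $ j) \<le> 0)"

text \<open>
  The strict order of the library on vectors is not the componentwise one, hence the
  explicit quantification over components.
\<close>

definition admissible ::
  "('p \<times> 'q) set \<Rightarrow> 'q set \<Rightarrow> ('z \<Rightarrow> 'p \<times> 'q \<Rightarrow> real^'h) \<Rightarrow>
   ('z \<Rightarrow> 'p \<times> 'q \<Rightarrow> real^'r) \<Rightarrow> 'z \<Rightarrow> 'q set" where
  "admissible Vbar Qbar h r z =
     {q \<in> Qbar. \<forall>j. 0 \<le> h z (root_of r Vbar z q, q) $ j}"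

definition strictly_admissible ::
  "('p \<times> 'q) set \<Rightarrow> 'q set \<Rightarrow> ('z \<Rightarrow> 'p \<times> 'q \<Rightarrow> real^'h) \<Rightarrow>
   ('z \<Rightarrow> 'p \<times> 'q \<Rightarrow> real^'r) \<Rightarrow> 'z \<Rightarrow> 'q set" where
  "strictly_admissible Vbar Qbar h r z =
     {q \<in> Qbar. \<forall>j. 0 < h z (root_of r Vbar z q, q) $ j}"

end

theory Submission
  imports Defs
begin

text \<open>
  A convex combination of \<open>g\<^sub>i, h\<^sub>1, \<dots>, h\<^sub>n\<close> with free weights can be made nonpositive exactly
  when one of these numbers is nonpositive, which turns the existence constraint into the
  disjunction. At strictly admissible \<open>q\<close> the disjunction forces \<open>g \<le> 0\<close>; by continuity of the root
  in \<open>q\<close> this persists on the closure of the strictly admissible indices, hence on all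
  admissible ones. Differentiability follows since the weighted sum is built from
  the data by projections, sums and products.
\<close>

section \<open>Calculus of repeatedly differentiable functions\<close>

text \<open>The same derivative serves as witness at the lower order, and the induction lowers the
  order of its directional components. The product rule relies on this, since the undifferentiated
  factors reappear in the derivative of a product.\<close>

lemma times_differentiable_on_SucD:
  "times_differentiable_on (Suc k) f S \<Longrightarrow> times_differentiable_on k f S"
proof (induction k arbitrary: f)
  case (Suc k)
  from Suc.prems obtain f' where
    f': "\<And>x. x \<in> S \<Longrightarrow> (f has_derivative f' x) (at x within S)"
    and "\<And>v. times_differentiable_on (Suc k) (\<lambda>x. f' x v) S"
    unfolding times_differentiable_on.simps(2)[of "Suc k"] by blast
  from this(2) have "times_differentiable_on k (\<lambda>x. f' x v) S" for v
    by (rule Suc.IH)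
  with f' show ?case by auto
qed simp

lemma times_differentiable_on_const: "times_differentiable_on k (\<lambda>x. c) S"
proof (induction k arbitrary: c)
  case (Suc k)
  show ?case
    unfolding times_differentiable_on.simps
    by (intro exI[of _ "\<lambda>x v. 0"] conjI ballI allI Suc.IH) (auto intro: derivative_intros)
qed simp

text \<open>The derivative of \<open>L\<close> is \<open>L\<close> at every point, so each
  directional component is constant in \<open>x\<close>.\<close>

lemma times_differentiable_on_linear:
  assumes "bounded_linear L"
  shows "times_differentiable_on k L S"
proof (cases k)
  case (Suc m)
  show ?thesis
    unfolding Suc times_differentiable_on.simps
    by (intro exI[of _ "\<lambda>x. L"] conjI ballI allI times_differentiable_on_const)
      (auto intro: assms bounded_linear_imp_has_derivative)
qed simp

lemma times_differentiable_on_add: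
  assumes "times_differentiable_on k f S" "times_differentiable_on k g S"
  shows "times_differentiable_on k (\<lambda>x. f x + g x) S"
  using assms
proof (induction k arbitrary: f g)
  case (Suc k)
  from Suc.prems obtain f' g' where
    "\<And>x. x \<in> S \<Longrightarrow> (f has_derivative f' x) (at x within S)"
    "\<And>v. times_differentiable_on k (\<lambda>x. f' x v) S"
    "\<And>x. x \<in> S \<Longrightarrow> (g has_derivative g' x) (at x within S)"
    "\<And>v. times_differentiable_on k (\<lambda>x. g' x v) S"
    unfolding times_differentiable_on.simps by metis
  then show ?case
    unfolding times_differentiable_on.simps
    by (intro exI[of _ "\<lambda>x v. f' x v + g' x v"] conjI ballI allI Suc.IH)
      (auto intro: has_derivative_add)
qed simp

lemma times_differentiable_on_mult:
  fixes f g :: "'a::real_normed_vector \<Rightarrow> 'b::real_normed_algebra"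
  assumes "times_differentiable_on k f S" "times_differentiable_on k g S"
  shows "times_differentiable_on k (\<lambda>x. f x * g x) S"
  using assms
proof (induction k arbitrary: f g)
  case (Suc k)
  from Suc.prems obtain f' g' where
    "\<And>x. x \<in> S \<Longrightarrow> (f has_derivative f' x) (at x within S)"
    "\<And>v. times_differentiable_on k (\<lambda>x. f' x v) S"
    "\<And>x. x \<in> S \<Longrightarrow> (g has_derivative g' x) (at x within S)"
    "\<And>v. times_differentiable_on k (\<lambda>x. g' x v) S"
    unfolding times_differentiable_on.simps by metis
  moreover have "times_differentiable_on k f S" "times_differentiable_on k g S"
    using Suc.prems[THEN times_differentiable_on_SucD] .
  ultimately show ?case
    unfolding times_differentiable_on.simps
    by (intro exI[of _ "\<lambda>x v. f x * g' x v + f' x v * g x"] conjI ballI allI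
        times_differentiable_on_add Suc.IH) (auto intro: has_derivative_mult)
qed simp

lemma times_differentiable_on_linear_left:
  assumes L: "bounded_linear L" and "times_differentiable_on k f S"
  shows "times_differentiable_on k (\<lambda>x. L (f x)) S"
  using assms(2)
proof (induction k arbitrary: f)
  case (Suc k)
  from Suc.prems obtain f' where
    "\<And>x. x \<in> S \<Longrightarrow> (f has_derivative f' x) (at x within S)"
    "\<And>v. times_differentiable_on k (\<lambda>x. f' x v) S"
    by auto
  then show ?case
    unfolding times_differentiable_on.simps
    by (intro exI[of _ "\<lambda>x v. L (f' x v)"] conjI ballI allI Suc.IH)
      (auto intro: bounded_linear.has_derivative[OF L])
qed simp

text \<open>A linear inner map keeps the chain rule within the induction: the direction
  \<open>L v\<close> does not depend on \<open>x\<close>, so each directional component of the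
  composite is a directional component of \<open>f\<close> composed with \<open>L\<close>
  again.\<close>

lemma times_differentiable_on_linear_right:
  assumes L: "bounded_linear L" and T: "L ` T \<subseteq> S" and "times_differentiable_on k f S"
  shows "times_differentiable_on k (\<lambda>x. f (L x)) T"
  using assms(3)
proof (induction k arbitrary: f)
  case (Suc k)
  from Suc.prems obtain f' where
    f': "\<And>x. x \<in> S \<Longrightarrow> (f has_derivative f' x) (at x within S)"
    and k: "\<And>v. times_differentiable_on k (\<lambda>x. f' x v) S"
    by auto
  have "((\<lambda>x. f (L x)) has_derivative (\<lambda>v. f' (L x) (L v))) (at x within T)" if "x \<in> T" for x
  proof (rule has_derivative_in_compose[where f = L and g = f])
    show "(L has_derivative L) (at x within T)"
      using L by (rule bounded_linear_imp_has_derivative)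
    show "(f has_derivative f' (L x)) (at (L x) within L ` T)"
      using f'[of "L x"] that T by (blast intro: has_derivative_subset)
  qed
  moreover have "times_differentiable_on k (\<lambda>x. f' (L x) (L v)) T" for v
    using Suc.IH[OF k[of "L v"]] by simp
  ultimately show ?case
    unfolding times_differentiable_on.simps
    by (intro exI[of _ "\<lambda>x v. f' (L x) (L v)"]) auto
qed simp

text \<open>For \<open>\<rho> = 0\<close> this is the definition; otherwise \<open>\<rho>\<close> is
  at least one, and a first derivative within \<open>S\<close> gives continuity. This treats both
  cases of the smoothness assumption alike in the exactness claim.\<close>

lemma C_class_continuous_on:
  assumes "C_class \<rho> f S"
  shows "continuous_on S f"
proof (cases "\<rho> = 0")
  case False
  then have "enat (Suc 0) \<le> \<rho>"
    by (cases \<rho>) (auto simp: zero_enat_def)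
  then have "times_differentiable_on (Suc 0) f S"
    using assms False unfolding C_class_def by metis
  then obtain f' where "\<And>x. x \<in> S \<Longrightarrow> (f has_derivative f' x) (at x within S)"
    unfolding times_differentiable_on.simps by metis
  then show ?thesis
    by (rule has_derivative_continuous_on)
qed (use assms in \<open>simp add: C_class_def\<close>)

lemma C_class_linear: "bounded_linear L \<Longrightarrow> C_class \<rho> L S"
  by (auto simp: C_class_def times_differentiable_on_linear linear_continuous_on)

lemma C_class_const: "C_class \<rho> (\<lambda>x. c) S"
  by (auto simp: C_class_def times_differentiable_on_const)

lemma C_class_add:
  "C_class \<rho> f S \<Longrightarrow> C_class \<rho> g S \<Longrightarrow> C_class \<rho> (\<lambda>x. f x + g x) S"
  by (auto simp: C_class_def times_differentiable_on_add continuous_on_add split: if_splits)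

lemma C_class_sum:
  "(\<And>j. j \<in> J \<Longrightarrow> C_class \<rho> (f j) S) \<Longrightarrow> C_class \<rho> (\<lambda>x. \<Sum>j\<in>J. f j x) S"
  by (induction J rule: infinite_finite_induct) (simp_all add: C_class_const C_class_add)

lemma C_class_mult:
  fixes f g :: "'a::real_normed_vector \<Rightarrow> 'b::real_normed_algebra"
  shows "C_class \<rho> f S \<Longrightarrow> C_class \<rho> g S \<Longrightarrow> C_class \<rho> (\<lambda>x. f x * g x) S"
  by (auto simp: C_class_def times_differentiable_on_mult continuous_on_mult split: if_splits)

lemma C_class_linear_left:
  "bounded_linear L \<Longrightarrow> C_class \<rho> f S \<Longrightarrow> C_class \<rho> (\<lambda>x. L (f x)) S"
  by (auto simp: C_class_def times_differentiable_on_linear_left bounded_linear.continuous_on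
      split: if_splits)

lemma C_class_linear_right:
  assumes L: "bounded_linear L" and "L ` T \<subseteq> S" "C_class \<rho> f S"
  shows "C_class \<rho> (\<lambda>x. f (L x)) T"
proof -
  have "continuous_on T (\<lambda>x. f (L x))" if "continuous_on S f"
    using that linear_continuous_on[OF L] assms(2) by (rule continuous_on_compose2)
  then show ?thesis
    using assms(3) times_differentiable_on_linear_right[OF assms(1,2)]
    by (auto simp: C_class_def split: if_splits)
qed

section \<open>Equivalence of the constraints\<close>

lemma axis_in_prob_simplex: "axis k 1 \<in> prob_simplex"
  by (simp add: prob_simplex_def axis_def)

lemma sum_option_UNIV:
  fixes c :: "'a::finite option \<Rightarrow> 'b::comm_monoid_add"
  shows "(\<Sum>x\<in>UNIV. c x) = c None + (\<Sum>j\<in>UNIV. c (Some j))"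
  by (simp add: UNIV_option_conv sum.reindex)

text \<open>If all numbers being averaged are positive, so is every convex combination of them; if
  one is nonpositive, the vertex of the simplex at its index selects it.\<close>

lemma ex_weighted_sum_nonpos_iff:
  fixes h :: "'z \<Rightarrow> 'v \<Rightarrow> real^'h"
  shows "(\<exists>l\<in>prob_simplex. weighted_sum g h i z v l \<le> 0) \<longleftrightarrow>
    g z v $ i \<le> 0 \<or> (\<exists>j. h z v $ j \<le> 0)" (is "?L \<longleftrightarrow> ?R")
proof
  \<comment> \<open>Collecting \<open>g z v $ i\<close> and the components of \<open>h z v\<close>
    in one family over \<open>'h option\<close> turns the weighted sum into a single inner product
    with \<open>l\<close>.\<close>
  define c where "c k = (case k of None \<Rightarrow> g z v $ i | Some j \<Rightarrow> h z v $ j)" for k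
  have ws: "weighted_sum g h i z v l = (\<Sum>k\<in>UNIV. l $ k * c k)" for l
    by (simp add: weighted_sum_def sum_option_UNIV c_def)
  have R: "?R \<longleftrightarrow> (\<exists>k. c k \<le> 0)"
    by (auto simp: c_def split: option.splits)
  show ?R if L: ?L
  proof (rule ccontr)
    assume "\<not> ?R"
    then have pos: "c k > 0" for k
      unfolding R by (simp add: not_le)
    obtain l where l: "(\<Sum>k\<in>UNIV. l $ k) = 1" "\<And>k. 0 \<le> l $ k" "(\<Sum>k\<in>UNIV. l $ k * c k) \<le> 0"
      using L unfolding ws prob_simplex_def by blast
    \<comment> \<open>Nonnegative terms with a nonpositive sum all vanish; as every
      \<open>c k\<close> is positive, all weights are then zero and cannot sum to one.\<close>
    have "0 \<le> l $ k * c k" for k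
      using l(2) pos[of k] by simp
    then have "l $ k * c k = 0" for k
      using l(3) by (metis (mono_tags, lifting) UNIV_I antisym finite sum_nonneg sum_nonneg_eq_0_iff)
    then have "l $ k = 0" for k
      using pos[of k] by (metis less_irrefl mult_eq_0_iff)
    then show False
      using l(1) by simp
  qed
  show ?L if ?R
  proof -
    obtain k where k: "c k \<le> 0"
      using \<open>?R\<close> R by blast
    have "weighted_sum g h i z v (axis k 1) = c k"
      by (simp add: ws axis_def if_distribR if_distrib[of "\<lambda>x. x * _"] cong: if_cong)
    then show ?L
      using k axis_in_prob_simplex by metis
  qed
qed

text \<open>The alternative on \<open>h\<close> does not depend on \<open>i\<close>, so it can be
  pulled out of the quantifier over \<open>i\<close>; the minimum over the finite index type is
  nonpositive exactly when some component is.\<close>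

lemma existence_sip_equivalent_disjunctive_sip:
  fixes g :: "'z \<Rightarrow> 'p \<times> 'q \<Rightarrow> real^'g" and h :: "'z \<Rightarrow> 'p \<times> 'q \<Rightarrow> real^'h"
  shows "equivalent (existence_sip Z Vbar Qbar f g h r) (disjunctive_sip Z Vbar Qbar f g h r)"
proof -
  have "(MIN j. h z v $ j) \<le> 0 \<longleftrightarrow> (\<exists>j. h z v $ j \<le> 0)" for z v
    by (subst Min_le_iff) auto
  then show ?thesis
    by (auto simp: equivalent_def feasible_def existence_sip_def disjunctive_sip_def
        ex_weighted_sum_nonpos_iff)
qed

text \<open>Links the programs, which quantify over all roots, with the admissible sets, which refer
  to the selected root.\<close>

lemma root_of_eqI:
  assumes "determined_part Z Vbar Qbar h r" "z \<in> Z" "q \<in> Qbar" "is_root r Vbar z q p"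
  shows "root_of r Vbar z q = p"
proof -
  have "\<exists>!p. is_root r Vbar z q p"
    using assms by (simp add: determined_part_def)
  then show ?thesis
    unfolding root_of_def using assms(4) by (rule the1_equality)
qed

lemma is_root_root_of:
  assumes "determined_part Z Vbar Qbar h r" "z \<in> Z" "q \<in> Qbar"
  shows "is_root r Vbar z q (root_of r Vbar z q)"
proof -
  have "\<exists>!p. is_root r Vbar z q p"
    using assms by (simp add: determined_part_def)
  then show ?thesis
    unfolding root_of_def by (rule theI')
qed

text \<open>The indices in \<open>Qbar\<close> at which the \<open>i\<close>-th component of
  \<open>g\<close> is nonpositive form a closed set. It contains the strictly admissible indices,
  hence their closure, hence by density all admissible ones.\<close>

lemma nonpos_at_root_if_admissible:
  fixes Z :: "(real^'z) set" and g :: "real^'z \<Rightarrow> (real^'r) \<times> (real^'q) \<Rightarrow> real^'g"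
  assumes det: "determined_part Z Vbar Qbar h r" and z: "z \<in> Z"
    and cont: "continuous_on (Z \<times> Vbar) (\<lambda>(z, v). g z v)"
    and dense: "admissible Vbar Qbar h r z \<subseteq> closure (strictly_admissible Vbar Qbar h r z)"
    and strict: "\<And>q. q \<in> strictly_admissible Vbar Qbar h r z \<Longrightarrow> g z (root_of r Vbar z q, q) $ i \<le> 0"
    and q: "q \<in> admissible Vbar Qbar h r z"
  shows "g z (root_of r Vbar z q, q) $ i \<le> 0"
proof -
  let ?p = "root_of r Vbar z"
  let ?N = "{q \<in> Qbar. g z (?p q, q) $ i \<le> 0}"
  have "closed Qbar"
    using det by (simp add: determined_part_def compact_imp_closed)
  have "continuous_on (Z \<times> Qbar) (\<lambda>(z, q). root_of r Vbar z q)"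
    using det by (simp add: determined_part_def)
  \<comment> \<open>Joint continuity of the root is restricted to the slice at the fixed
    \<open>z\<close>.\<close>
  then have "continuous_on Qbar (\<lambda>q. case (z, q) of (z, q) \<Rightarrow> root_of r Vbar z q)"
    by (rule continuous_on_compose2) (use z in \<open>auto intro!: continuous_intros\<close>)
  then have "continuous_on Qbar (\<lambda>q. (z, ?p q, q))"
    by (auto intro!: continuous_intros)
  moreover have "(\<lambda>q. (z, ?p q, q)) ` Qbar \<subseteq> Z \<times> Vbar"
    using z is_root_root_of[OF det z] by (auto simp: is_root_def)
  ultimately have "continuous_on Qbar (\<lambda>q. case (z, ?p q, q) of (z, v) \<Rightarrow> g z v)"
    by (rule continuous_on_compose2[OF cont])
  then have "continuous_on Qbar (\<lambda>q. g z (?p q, q) $ i)"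
    by (auto intro!: continuous_intros)
  then have "closed ?N"
    using continuous_on_closed_Collect_le[OF _ continuous_on_const \<open>closed Qbar\<close>] by blast
  moreover have "strictly_admissible Vbar Qbar h r z \<subseteq> ?N"
    using strict by (auto simp: strictly_admissible_def)
  ultimately have "closure (strictly_admissible Vbar Qbar h r z) \<subseteq> ?N"
    by (simp add: closure_minimal)
  then show ?thesis
    using dense q by blast
qed

text \<open>From (E) to the GSIP, density and continuity extend \<open>g \<le> 0\<close> from
  strictly admissible indices to all admissible ones. Conversely, a root at which no component of
  \<open>h\<close> is nonpositive lies in \<open>lower_set\<close>, where the GSIP gives
  \<open>g \<le> 0\<close>.\<close>

lemma existence_sip_equivalent_gsip:
  fixes Z :: "(real^'z) set" and Vbar :: "((real^'r) \<times> (real^'q)) set"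
    and g :: "real^'z \<Rightarrow> (real^'r) \<times> (real^'q) \<Rightarrow> real^'g"
  assumes det: "determined_part Z Vbar Qbar h r"
    and cont: "continuous_on (Z \<times> Vbar) (\<lambda>(z, v). g z v)"
    and dense: "\<And>z. z \<in> Z \<Longrightarrow>
      admissible Vbar Qbar h r z \<subseteq> closure (strictly_admissible Vbar Qbar h r z)"
  shows "equivalent (existence_sip Z Vbar Qbar f g h r) (gsip Z Vbar f g h r)"
proof -
  \<comment> \<open>The multipliers are already eliminated here;
    \<open>ex_weighted_sum_nonpos_iff\<close> restores them at the end.\<close>
  have "(\<forall>q\<in>Qbar. \<forall>p. is_root r Vbar z q p \<longrightarrow>
      (\<forall>i. g z (p, q) $ i \<le> 0 \<or> (\<exists>j. h z (p, q) $ j \<le> 0))) \<longleftrightarrow>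
    (\<forall>v\<in>lower_set Vbar h r z. \<forall>i. g z v $ i \<le> 0)" (is "?E \<longleftrightarrow> ?G")
    if z: "z \<in> Z" for z
  proof
    assume E: ?E
    show ?G
    proof clarify
      fix p q i
      assume pq: "(p, q) \<in> lower_set Vbar h r z"
      then have q: "q \<in> Qbar"
        using det z unfolding determined_part_def by blast
      have p: "root_of r Vbar z q = p"
        using pq by (intro root_of_eqI[OF det z q]) (simp add: lower_set_def is_root_def)
      have "g z (root_of r Vbar z q, q) $ i \<le> 0"
      proof (rule nonpos_at_root_if_admissible[OF det z cont dense[OF z]])
        show "g z (root_of r Vbar z q', q') $ i \<le> 0"
          if "q' \<in> strictly_admissible Vbar Qbar h r z" for q'
        proof -
          have q': "q' \<in> Qbar" and "\<And>j. 0 < h z (root_of r Vbar z q', q') $ j"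
            using that by (auto simp: strictly_admissible_def)
          \<comment> \<open>At a strictly admissible index the alternative on \<open>h\<close>
            fails, so the disjunction leaves only the bound on \<open>g\<close>.\<close>
          then show ?thesis
            using E is_root_root_of[OF det z q'] by (meson not_le)
        qed
        show "q \<in> admissible Vbar Qbar h r z"
          using pq p q by (simp add: admissible_def lower_set_def)
      qed
      then show "g z (p, q) $ i \<le> 0"
        by (simp add: p)
    qed
  next
    assume ?G
    then show ?E
      unfolding lower_set_def is_root_def by (force simp: not_le intro: less_imp_le)
  qed
  then show ?thesis
    by (auto simp: equivalent_def feasible_def existence_sip_def gsip_def
        ex_weighted_sum_nonpos_iff)
qed

section \<open>Smoothness of the constraint functions\<close>

text \<open>The data enter through linear projections of \<open>(z, p, q, l)\<close> and each
  multiplier is a linear coordinate, so closure under linear maps, sums and products suffices.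
  Keeping \<open>p\<close> as a variable means that the root map is never differentiated.\<close>

lemma C_class_constraint_functions:
  fixes Z :: "(real^'z) set" and Vbar :: "((real^'r) \<times> (real^'q)) set"
    and h :: "real^'z \<Rightarrow> (real^'r) \<times> (real^'q) \<Rightarrow> real^'h"
  defines "D \<equiv> {(z, p, q, l :: real^('h option)). z \<in> Z \<and> (p, q) \<in> Vbar}"
  assumes smooth: "smooth_data \<rho> Z Vbar f g h r"
  shows "C_class \<rho> (\<lambda>(z, p, q, l). f z) D"
    and "C_class \<rho> (\<lambda>(z, p, q, l). r z (p, q)) D"
    and "C_class \<rho> (\<lambda>(z, p, q, l). weighted_sum g h i z (p, q) l) D"
proof -
  \<comment> \<open>This projection forgets the multipliers and regroups the rest as
    \<open>(z, (p, q))\<close>, the argument of the uncurried data.\<close>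
  let ?zv = "\<lambda>x::(real^'z) \<times> (real^'r) \<times> (real^'q) \<times> (real^('h option)).
    (fst x, fst (snd x), fst (snd (snd x)))"
  have zv: "bounded_linear ?zv" "?zv ` D \<subseteq> Z \<times> Vbar"
    by (auto simp: D_def intro!: bounded_linear_intros)
  have data: "C_class \<rho> (\<lambda>x. g (fst x) (fst (snd x), fst (snd (snd x)))) D"
    "C_class \<rho> (\<lambda>x. h (fst x) (fst (snd x), fst (snd (snd x)))) D"
    "C_class \<rho> (\<lambda>x. r (fst x) (fst (snd x), fst (snd (snd x)))) D"
    using smooth unfolding smooth_data_def
    by (auto dest!: C_class_linear_right[OF zv])
  have l: "C_class \<rho> (\<lambda>x. snd (snd (snd x)) $ k) D" for k
    by (intro C_class_linear_left[OF bounded_linear_vec_nth] C_class_linear bounded_linear_intros)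
  have "C_class \<rho> (\<lambda>x. f (fst x)) D"
    using smooth unfolding smooth_data_def
    by (intro C_class_linear_right[OF bounded_linear_fst, of _ Z]) (auto simp: D_def)
  then show "C_class \<rho> (\<lambda>(z, p, q, l). f z) D"
    by (simp add: case_prod_unfold)
  show "C_class \<rho> (\<lambda>(z, p, q, l). r z (p, q)) D"
    using data(3) by (simp add: case_prod_unfold)
  show "C_class \<rho> (\<lambda>(z, p, q, l). weighted_sum g h i z (p, q) l) D"
    unfolding weighted_sum_def case_prod_unfold
    by (intro C_class_add C_class_mult C_class_sum l data
        C_class_linear_left[OF bounded_linear_vec_nth])
qed

theorem theorem1:
  fixes Z :: "(real^'z) set"
    and Vbar :: "((real^'r) \<times> (real^'q)) set"
    and Qbar :: "(real^'q) set"
    and f :: "real^'z \<Rightarrow> real"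
    and g :: "real^'z \<Rightarrow> (real^'r) \<times> (real^'q) \<Rightarrow> real^'g"
    and h :: "real^'z \<Rightarrow> (real^'r) \<times> (real^'q) \<Rightarrow> real^'h"
    and r :: "real^'z \<Rightarrow> (real^'r) \<times> (real^'q) \<Rightarrow> real^'r"
    and \<rho> :: enat
  assumes "bounded Vbar"
    and "determined_part Z Vbar Qbar h r"
  shows
    "equivalent (existence_sip Z Vbar Qbar f g h r) (disjunctive_sip Z Vbar Qbar f g h r) \<and>
     (smooth_data \<rho> Z Vbar f g h r \<and>
      (\<forall>z\<in>Z. admissible Vbar Qbar h r z \<subseteq> closure (strictly_admissible Vbar Qbar h r z))
        \<longrightarrow> equivalent (existence_sip Z Vbar Qbar f g h r) (gsip Z Vbar f g h r)) \<and>
     (smooth_data \<rho> Z Vbar f g h r \<longrightarrow>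
        (let D = {(z, p, q, l :: real^('h option)). z \<in> Z \<and> (p, q) \<in> Vbar} in
           C_class \<rho> (\<lambda>(z, p, q, l). f z) D \<and>
           C_class \<rho> (\<lambda>(z, p, q, l). r z (p, q)) D \<and>
           (\<forall>i. C_class \<rho> (\<lambda>(z, p, q, l). weighted_sum g h i z (p, q) l) D)))"
proof (intro conjI impI)
  show "equivalent (existence_sip Z Vbar Qbar f g h r) (disjunctive_sip Z Vbar Qbar f g h r)"
    by (rule existence_sip_equivalent_disjunctive_sip)
next
  assume asm: "smooth_data \<rho> Z Vbar f g h r \<and>
    (\<forall>z\<in>Z. admissible Vbar Qbar h r z \<subseteq> closure (strictly_admissible Vbar Qbar h r z))"
  then have "continuous_on (Z \<times> Vbar) (\<lambda>(z, v). g z v)"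
    by (auto simp: smooth_data_def intro: C_class_continuous_on)
  with assms(2) asm show "equivalent (existence_sip Z Vbar Qbar f g h r) (gsip Z Vbar f g h r)"
    by (intro existence_sip_equivalent_gsip) auto
next
  assume "smooth_data \<rho> Z Vbar f g h r"
  from C_class_constraint_functions[OF this]
  show "let D = {(z, p, q, l :: real^('h option)). z \<in> Z \<and> (p, q) \<in> Vbar} in
      C_class \<rho> (\<lambda>(z, p, q, l). f z) D \<and>
      C_class \<rho> (\<lambda>(z, p, q, l). r z (p, q)) D \<and>
      (\<forall>i. C_class \<rho> (\<lambda>(z, p, q, l). weighted_sum g h i z (p, q) l) D)"
    by (simp add: Let_def)
qed

end
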